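(* Let $f$ and $g$ be entire functions of $n$ complex variables with index-pairs $(m,q)$ and $(m,p)$ respectively, where $m,p,q$ are integers with $m\ge q\ge 1$ and $m\ge p\ge 1$, and let $D$ be a bounded complete $n$-circular domain with center at the origin in $\mathbb{C}^n$ (used to compute the orders below). Then $$\frac{\lambda_f(m,q)}{\rho_g(m,p)}\le \lambda_g^{(p,q)}(f)\le \min\left\{\frac{\lambda_f(m,q)}{\lambda_g(m,p)},\frac{\rho_f(m,q)}{\rho_g(m,p)}\right\}\le \max\left\{\frac{\lambda_f(m,q)}{\lambda_g(m,p)},\frac{\rho_f(m,q)}{\rho_g(m,p)}\right\}\le \rho_g^{(p,q)}(f)\le \frac{\rho_f(m,q)}{\lambda_g(m,p)}.$$
   Context: All entire functions are transcendental. A bounded complete $n$-circular domain with center at the origin is a nonempty bounded open set $D\subset\mathbb{C}^n$ such that $z\in D$ and $|w_j|\le|z_j|$ for $1\le j\le n$ imply $w\in D$. For $f$ entire on $\mathbb{C}^n$ and $R>0$, $M_{f,D}(R)=\sup\{|f(z)|: z/R\in D\}$; it is strictly increasing and has an inverse $M_{f,D}^{-1}:(|f(0)|,\infty)\to(0,\infty)$ tending to infinity. $M_{g,D}^{-1}M_{f,D}(R)$ means $M_{g,D}^{-1}(M_{f,D}(R))$. $\log^{[0]}x=x$, $\log^{[k]}x=\log(\log^{[k-1]}x)$. Orders: $\rho_f(m,q)=\limsup_{R\to\infty}\frac{\log^{[m]}M_{f,D}(R)}{\log^{[q]}R}$ and $\lambda_f(m,q)=\liminf_{R\to\infty}\frac{\log^{[m]}M_{f,D}(R)}{\log^{[q]}R}$;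 these do not depend on $D$. $f$ has index-pair $(1,1)$ if $0<\rho_f(1,1)<\infty$; otherwise $f$ has index-pair $(m,q)\ne(1,1)$, $m\ge q\ge1$, if $\delta_{m-q,0}<\rho_f(m,q)<\infty$ and $\rho_f(m-1,q-1)$ is not a positive real number, where $\delta_{i,j}=1$ if $i=j$ and $0$ otherwise. Relative orders: $\rho_g^{(p,q)}(f)=\limsup_{R\to\infty}\frac{\log^{[p]}M_{g,D}^{-1}M_{f,D}(R)}{\log^{[q]}R}$ and $\lambda_g^{(p,q)}(f)$ is the corresponding $\liminf$; these do not depend on $D$. Convention: quantities lie in $[0,\infty]$, with $a/0=\infty$ for $a>0$; an indeterminate quotient $0/0$ is omitted (no assertion is made about it). *)

theory Defs
  imports "HOL-Analysis.Analysis"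
begin

text \<open>Several complex variables: the Frechet derivative must be complex-linear.
  The index type of the vectors plays the role of \<open>{1..n}\<close>.\<close>

definition entire :: "(complex ^ 'n \<Rightarrow> complex) \<Rightarrow> bool" where
  "entire f \<longleftrightarrow>
     (\<forall>z. \<exists>L. (f has_derivative L) (at z) \<and> (\<forall>c v. L (c *s v) = c * L v))"

text \<open>A multi-index is a function \<open>'n \<Rightarrow> nat\<close>; \<open>A\<close> collects the finitely many monomials.\<close>

definition polynomial_map :: "(complex ^ 'n \<Rightarrow> complex) \<Rightarrow> bool" where
  "polynomial_map f \<longleftrightarrow>
     (\<exists>(A :: ('n \<Rightarrow> nat) set) c. finite A \<and>
        (\<forall>z. f z = (\<Sum>\<alpha>\<in>A. c \<alpha> * (\<Prod>j\<in>UNIV. (z $ j) ^ \<alpha> j))))"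

definition transcendental_entire :: "(complex ^ 'n \<Rightarrow> complex) \<Rightarrow> bool" where
  "transcendental_entire f \<longleftrightarrow> entire f \<and> \<not> polynomial_map f"

definition bounded_complete_circular_domain :: "(complex ^ 'n) set \<Rightarrow> bool" where
  "bounded_complete_circular_domain D \<longleftrightarrow>
     D \<noteq> {} \<and> bounded D \<and> open D \<and>
     (\<forall>z\<in>D. \<forall>w. (\<forall>j. cmod (w $ j) \<le> cmod (z $ j)) \<longrightarrow> w \<in> D)"

text \<open>The supremum is a real number because \<open>D\<close> is bounded and nonempty and \<open>f\<close> is continuous.\<close>

definition max_modulus :: "(complex ^ 'n) set \<Rightarrow> (complex ^ 'n \<Rightarrow> complex) \<Rightarrow> real \<Rightarrow> real" where
  "max_modulus D f R = Sup {cmod (f z) |z. z /\<^sub>R R \<in> D}"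

text \<open>Meaningful for arguments greater than \<open>cmod (f 0)\<close>.\<close>

definition inv_max_modulus :: "(complex ^ 'n) set \<Rightarrow> (complex ^ 'n \<Rightarrow> complex) \<Rightarrow> real \<Rightarrow> real" where
  "inv_max_modulus D f = the_inv_into {0<..} (max_modulus D f)"

definition iter_ln :: "nat \<Rightarrow> real \<Rightarrow> real" where
  "iter_ln k = ln ^^ k"

text \<open>For transcendental entire functions, all numerators and denominators below tend to infinity, so
  the values of \<open>ln\<close> at nonpositive arguments and division by zero do not affect the limits,
  which lie in \<open>[0, \<infinity>]\<close>.\<close>

definition upper_order ::
  "(complex ^ 'n) set \<Rightarrow> nat \<Rightarrow> nat \<Rightarrow> (complex ^ 'n \<Rightarrow> complex) \<Rightarrow> ereal" where
  "upper_order D m q f =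
     Limsup at_top (\<lambda>R. ereal (iter_ln m (max_modulus D f R) / iter_ln q R))"

definition lower_order ::
  "(complex ^ 'n) set \<Rightarrow> nat \<Rightarrow> nat \<Rightarrow> (complex ^ 'n \<Rightarrow> complex) \<Rightarrow> ereal" where
  "lower_order D m q f =
     Liminf at_top (\<lambda>R. ereal (iter_ln m (max_modulus D f R) / iter_ln q R))"

definition has_index_pair ::
  "(complex ^ 'n) set \<Rightarrow> (complex ^ 'n \<Rightarrow> complex) \<Rightarrow> nat \<Rightarrow> nat \<Rightarrow> bool" where
  "has_index_pair D f m q \<longleftrightarrow>
     (if 0 < upper_order D 1 1 f \<and> upper_order D 1 1 f < \<infinity> then m = 1 \<and> q = 1
      else (m, q) \<noteq> (1, 1) \<and> q \<le> m \<and> 1 \<le> q \<and>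
        (if m = q then 1 else 0) < upper_order D m q f \<and> upper_order D m q f < \<infinity> \<and>
        \<not> (0 < upper_order D (m - 1) (q - 1) f \<and> upper_order D (m - 1) (q - 1) f < \<infinity>))"

definition relative_upper_order ::
  "(complex ^ 'n) set \<Rightarrow> nat \<Rightarrow> nat \<Rightarrow> (complex ^ 'n \<Rightarrow> complex) \<Rightarrow> (complex ^ 'n \<Rightarrow> complex) \<Rightarrow> ereal" where
  "relative_upper_order D p q g f =
     Limsup at_top (\<lambda>R. ereal (iter_ln p (inv_max_modulus D g (max_modulus D f R)) / iter_ln q R))"

definition relative_lower_order ::
  "(complex ^ 'n) set \<Rightarrow> nat \<Rightarrow> nat \<Rightarrow> (complex ^ 'n \<Rightarrow> complex) \<Rightarrow> (complex ^ 'n \<Rightarrow> complex) \<Rightarrow> ereal" where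
  "relative_lower_order D p q g f =
     Liminf at_top (\<lambda>R. ereal (iter_ln p (inv_max_modulus D g (max_modulus D f R)) / iter_ln q R))"

text \<open>The quotients \<open>a / b\<close>, given as pairs, with the indeterminate \<open>0 / 0\<close> omitted.
  Division on \<open>ereal\<close> already satisfies \<open>a / 0 = \<infinity>\<close> for \<open>a > 0\<close>.\<close>

definition determinate_quotients :: "(ereal \<times> ereal) set \<Rightarrow> ereal set" where
  "determinate_quotients P = {a / b |a b. (a, b) \<in> P \<and> \<not> (a = 0 \<and> b = 0)}"

end

theory Submission
  imports Defs "HOL-Complex_Analysis.Conformal_Mappings"
begin

text \<open>
  Write \<open>F\<close> and \<open>G\<close> for the maximum moduli of \<open>f\<close> and \<open>g\<close>, and let \<open>h = G\<^sup>-\<^sup>1 \<circ> F\<close>. Since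
  \<open>G (h R) = F R\<close>, the quotient that defines the relative order of \<open>f\<close> factors for large \<open>R\<close> as
  \<open>a R / b (h R)\<close>, where \<open>a R = log\<^sup>[\<^sup>m\<^sup>] F R / log\<^sup>[\<^sup>q\<^sup>] R\<close> and
  \<open>b r = log\<^sup>[\<^sup>m\<^sup>] G r / log\<^sup>[\<^sup>p\<^sup>] r\<close> are the quotients that define the orders of \<open>f\<close> and \<open>g\<close>.

  The inequalities then express how upper and lower limits of a quotient of positive functions
  are controlled by those of numerator and denominator, provided that \<open>b \<circ> h\<close> and \<open>b\<close> have the
  same upper and lower limits at infinity. For the two inner bounds it would not suffice that
  \<open>h\<close> tends to infinity: \<open>h\<close> must not skip the radii where \<open>b\<close> is close to its extreme limits.
  It skips none, because \<open>F\<^sup>-\<^sup>1 \<circ> G\<close> inverts it near infinity; in terms of filters, \<open>h\<close> maps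
  \<open>at_top\<close> onto \<open>at_top\<close> (\<open>filtermap_inv_max_modulus_max_modulus\<close>).

  The analytic content is that the maximum modulus of a nonconstant entire function maps
  \<open>{0<..}\<close> strictly increasingly onto \<open>{cmod (f 0)<..}\<close> (\<open>strict_mono_on_max_modulus\<close>,
  \<open>max_modulus_image\<close>). Everything there is reduced to one variable by restricting \<open>f\<close> to complex
  lines through the origin, on which Liouville's theorem and the maximum modulus principle
  apply.
\<close>

section \<open>Upper and lower limits of quotients\<close>

text \<open>An upper or lower limit depends on the filter only through the eventual bounds, and those are
  transported by \<open>filtermap\<close>.\<close>

lemma Limsup_filtermap:
  fixes u :: "'b \<Rightarrow> 'c :: complete_linorder"
  shows "Limsup (filtermap h F) u = Limsup F (\<lambda>x. u (h x))"
  by (intro antisym) (auto simp: Limsup_le_iff eventually_filtermap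
      dest: Limsup_lessD[where F = F] Limsup_lessD[where F = "filtermap h F"])

lemma Liminf_filtermap:
  fixes u :: "'b \<Rightarrow> 'c :: complete_linorder"
  shows "Liminf (filtermap h F) u = Liminf F (\<lambda>x. u (h x))"
  by (intro antisym) (auto simp: le_Liminf_iff eventually_filtermap
      dest: less_LiminfD[where F = F] less_LiminfD[where F = "filtermap h F"])

lemma Liminf_le_Limsup_frequently:
  fixes u v :: "'a \<Rightarrow> ereal"
  assumes "\<exists>\<^sub>F x in F. u x \<le> v x"
  shows "Liminf F u \<le> Limsup F v"
proof (rule ccontr)
  assume "\<not> Liminf F u \<le> Limsup F v"
  then obtain t where t: "Limsup F v < t" "t < Liminf F u"
    using dense by (metis not_le)
  have "\<forall>\<^sub>F x in F. \<not> u x \<le> v x"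
    using Limsup_lessD[OF t(1)] less_LiminfD[OF t(2)] by eventually_elim auto
  with assms show False
    by (simp add: frequently_def)
qed

text \<open>The next two rules reduce an inequality with an extended quotient to product inequalities with
  positive real factors \<open>s\<close>, where no undefined product such as \<open>0 * \<infinity>\<close> can occur. The factors
  range over a half-line only, so that \<open>s\<close> can later be a strict bound of a limit. The value
  \<open>l / 0\<close> is \<open>\<infinity>\<close> for \<open>l > 0\<close>: in the first rule this makes the claim trivial, in the second it
  contradicts \<open>l \<le> s * 0\<close> unless \<open>X = \<infinity>\<close>.\<close>

lemma le_ereal_quotientI:
  fixes X l l' :: ereal
  assumes "\<And>s::real. 0 < s \<Longrightarrow> ereal s < X \<Longrightarrow> ereal s * l' \<le> l"
    and "0 \<le> l" "0 \<le> l'" "l' < \<infinity>" "\<not> (l = 0 \<and> l' = 0)"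
  shows "X \<le> l / l'"
proof (cases "l' = 0")
  case True
  with assms have "l / l' = \<infinity>" by (cases l) (auto simp: divide_ereal_def)
  then show ?thesis by simp
next
  case False
  with assms have l': "0 < l'" "l' \<noteq> \<infinity>" by auto
  show ?thesis
  proof (rule dense_le)
    fix y assume y: "y < X"
    show "y \<le> l / l'"
    proof (cases "y \<le> 0")
      case True
      also have "0 \<le> l / l'" using assms l' by (cases l; cases l') auto
      finally show ?thesis .
    next
      case False
      with y obtain s where s: "y = ereal s" "0 < s" by (cases y) auto
      with assms(1)[of s] y l' show ?thesis
        by (simp add: ereal_le_divide_pos mult.commute)
    qed
  qed
qed

lemma ereal_quotient_leI:
  fixes X l l' :: ereal
  assumes "\<And>s::real. 0 < s \<Longrightarrow> X < ereal s \<Longrightarrow> l \<le> ereal s * l'"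
    and "0 \<le> X" "0 \<le> l" "0 \<le> l'" "l' < \<infinity>" "\<not> (l = 0 \<and> l' = 0)"
  shows "l / l' \<le> X"
proof (rule dense_ge)
  fix y assume y: "X < y"
  show "l / l' \<le> y"
  proof (cases y)
    case (real s)
    with y assms(2) have "0 < s" using order_le_less_trans by fastforce
    with assms(1)[of s] y real have *: "l \<le> ereal s * l'" by simp
    with assms have "0 < l'" by (cases "l' = 0") auto
    with * assms real show ?thesis
      by (simp add: ereal_divide_le_pos mult.commute)
  qed (use y assms in auto)
qed

text \<open>All bounds for a quotient \<open>a / b\<close> come from one observation. A strict bound \<open>s\<close> for a limit of
  \<open>a / b\<close> compares \<open>a\<close> with \<open>s * b\<close>: eventually if \<open>s\<close> lies below the lower or above the upper
  limit, and frequently if it lies below the upper or above the lower limit. An eventual comparison passes to lower limits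
  and to upper limits alike; a frequent one only bounds the lower limit of the smaller side by
  the upper limit of the larger side.\<close>

context
  fixes F :: "'a filter" and a b :: "'a \<Rightarrow> real"
  assumes F: "F \<noteq> bot"
    and pos: "\<forall>\<^sub>F x in F. 0 < a x \<and> 0 < b x"
    and fin: "Limsup F (\<lambda>x. ereal (b x)) < \<infinity>"
begin

lemma Liminf_nonneg:
  "0 \<le> Liminf F (\<lambda>x. ereal (a x))" "0 \<le> Liminf F (\<lambda>x. ereal (b x))"
  "0 \<le> Liminf F (\<lambda>x. ereal (a x / b x))"
  using pos by (auto intro!: Liminf_bounded elim!: eventually_mono)

lemma Limsup_nonneg:
  "0 \<le> Limsup F (\<lambda>x. ereal (a x))" "0 \<le> Limsup F (\<lambda>x. ereal (b x))"
  "0 \<le> Limsup F (\<lambda>x. ereal (a x / b x))"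
  using Liminf_nonneg Liminf_le_Limsup[OF F] order_trans by blast+

lemma Liminf_fin: "Liminf F (\<lambda>x. ereal (b x)) < \<infinity>"
  using fin Liminf_le_Limsup[OF F] order_le_less_trans by blast

lemma Liminf_scale:
  "0 < s \<Longrightarrow> ereal s * Liminf F (\<lambda>x. ereal (b x)) = Liminf F (\<lambda>x. ereal (s * b x))"
  using Liminf_ereal_mult_left[OF F, of s "\<lambda>x. ereal (b x)"] by simp

lemma Limsup_scale:
  "0 < s \<Longrightarrow> ereal s * Limsup F (\<lambda>x. ereal (b x)) = Limsup F (\<lambda>x. ereal (s * b x))"
  using Limsup_ereal_mult_left[OF F, of s "\<lambda>x. ereal (b x)"] by simp

lemma eventually_above:
  assumes "ereal s < Liminf F (\<lambda>x. ereal (a x / b x))"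
  shows "\<forall>\<^sub>F x in F. ereal (s * b x) \<le> ereal (a x)"
  using less_LiminfD[OF assms] pos by eventually_elim (simp add: field_simps)

lemma eventually_below:
  assumes "Limsup F (\<lambda>x. ereal (a x / b x)) < ereal s"
  shows "\<forall>\<^sub>F x in F. ereal (a x) \<le> ereal (s * b x)"
  using Limsup_lessD[OF assms] pos by eventually_elim (simp add: field_simps)

lemma frequently_above:
  assumes "ereal s < Limsup F (\<lambda>x. ereal (a x / b x))"
  shows "\<exists>\<^sub>F x in F. ereal (s * b x) \<le> ereal (a x)"
proof (rule ccontr)
  assume "\<not> ?thesis"
  then have "\<forall>\<^sub>F x in F. \<not> s * b x \<le> a x" by (simp add: frequently_def)
  with pos have "\<forall>\<^sub>F x in F. ereal (a x / b x) \<le> ereal s"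
    by eventually_elim (simp add: field_simps)
  then have "Limsup F (\<lambda>x. ereal (a x / b x)) \<le> ereal s" by (rule Limsup_bounded)
  with assms show False by simp
qed

lemma frequently_below:
  assumes "Liminf F (\<lambda>x. ereal (a x / b x)) < ereal s"
  shows "\<exists>\<^sub>F x in F. ereal (a x) \<le> ereal (s * b x)"
proof (rule ccontr)
  assume "\<not> ?thesis"
  then have "\<forall>\<^sub>F x in F. \<not> a x \<le> s * b x" by (simp add: frequently_def)
  with pos have "\<forall>\<^sub>F x in F. ereal s \<le> ereal (a x / b x)"
    by eventually_elim (simp add: field_simps)
  then have "ereal s \<le> Liminf F (\<lambda>x. ereal (a x / b x))" by (rule Liminf_bounded)
  with assms show False by simp
qed

lemma Liminf_quotient_le_Liminf:
  assumes "\<not> (Liminf F (\<lambda>x. ereal (a x)) = 0 \<and> Liminf F (\<lambda>x. ereal (b x)) = 0)"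
  shows "Liminf F (\<lambda>x. ereal (a x / b x)) \<le> Liminf F (\<lambda>x. ereal (a x)) / Liminf F (\<lambda>x. ereal (b x))"
  using assms Liminf_nonneg Liminf_fin Liminf_mono[OF eventually_above] Liminf_scale
  by (intro le_ereal_quotientI) auto

lemma Liminf_quotient_le_Limsup:
  assumes "\<not> (Limsup F (\<lambda>x. ereal (a x)) = 0 \<and> Limsup F (\<lambda>x. ereal (b x)) = 0)"
  shows "Liminf F (\<lambda>x. ereal (a x / b x)) \<le> Limsup F (\<lambda>x. ereal (a x)) / Limsup F (\<lambda>x. ereal (b x))"
  using assms Limsup_nonneg fin Limsup_mono[OF eventually_above] Limsup_scale
  by (intro le_ereal_quotientI) auto

lemma Limsup_quotient_le:
  assumes "\<not> (Limsup F (\<lambda>x. ereal (a x)) = 0 \<and> Liminf F (\<lambda>x. ereal (b x)) = 0)"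
  shows "Limsup F (\<lambda>x. ereal (a x / b x)) \<le> Limsup F (\<lambda>x. ereal (a x)) / Liminf F (\<lambda>x. ereal (b x))"
  using assms Limsup_nonneg Liminf_nonneg Liminf_fin
    Liminf_le_Limsup_frequently[OF frequently_above] Liminf_scale
  by (intro le_ereal_quotientI) auto

lemma Limsup_quotient_ge_Liminf:
  assumes "\<not> (Liminf F (\<lambda>x. ereal (a x)) = 0 \<and> Liminf F (\<lambda>x. ereal (b x)) = 0)"
  shows "Liminf F (\<lambda>x. ereal (a x)) / Liminf F (\<lambda>x. ereal (b x)) \<le> Limsup F (\<lambda>x. ereal (a x / b x))"
  using assms Limsup_nonneg Liminf_nonneg Liminf_fin Liminf_mono[OF eventually_below] Liminf_scale
  by (intro ereal_quotient_leI) auto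

lemma Limsup_quotient_ge_Limsup:
  assumes "\<not> (Limsup F (\<lambda>x. ereal (a x)) = 0 \<and> Limsup F (\<lambda>x. ereal (b x)) = 0)"
  shows "Limsup F (\<lambda>x. ereal (a x)) / Limsup F (\<lambda>x. ereal (b x)) \<le> Limsup F (\<lambda>x. ereal (a x / b x))"
  using assms Limsup_nonneg fin Limsup_mono[OF eventually_below] Limsup_scale
  by (intro ereal_quotient_leI) auto

lemma Liminf_quotient_ge:
  assumes "\<not> (Liminf F (\<lambda>x. ereal (a x)) = 0 \<and> Limsup F (\<lambda>x. ereal (b x)) = 0)"
  shows "Liminf F (\<lambda>x. ereal (a x)) / Limsup F (\<lambda>x. ereal (b x)) \<le> Liminf F (\<lambda>x. ereal (a x / b x))"
  using assms Limsup_nonneg Liminf_nonneg fin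
    Liminf_le_Limsup_frequently[OF frequently_below] Limsup_scale
  by (intro ereal_quotient_leI) auto

end

section \<open>Restriction of entire functions to complex lines\<close>

lemma entire_continuous_on:
  assumes "entire f"
  shows "continuous_on S f"
  using assms unfolding entire_def
  by (meson continuous_at_imp_continuous_on has_derivative_continuous)

lemma bounded_linear_complex_line: "bounded_linear (\<lambda>t::complex. t *s w)"
  unfolding linear_conv_bounded_linear[symmetric]
  by (rule linearI) (simp_all add: vec_eq_iff algebra_simps)

lemma entire_line_holomorphic:
  assumes "entire f"
  shows "(\<lambda>t. f (t *s w)) holomorphic_on UNIV"
  unfolding holomorphic_on_def
proof
  fix t :: complex
  \<comment> \<open>Complex linearity of the derivative turns the real chain rule into complex differentiability.\<close>
  obtain L where L: "(f has_derivative L) (at (t *s w))" "\<And>c v. L (c *s v) = c * L v"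
    using assms unfolding entire_def by blast
  have "((\<lambda>t. f (t *s w)) has_derivative (\<lambda>h. L (h *s w))) (at t)"
    using has_derivative_compose[OF bounded_linear_imp_has_derivative[OF bounded_linear_complex_line] L(1)] .
  then have "((\<lambda>t. f (t *s w)) has_field_derivative L w) (at t)"
    by (simp add: has_field_derivative_def L(2) mult_commute_abs)
  then show "(\<lambda>t. f (t *s w)) field_differentiable at t within UNIV"
    using field_differentiable_def by auto
qed

lemma transcendental_entire_not_constant:
  assumes "transcendental_entire f"
  shows "\<exists>z. f z \<noteq> f 0"
proof (rule ccontr)
  assume const: "\<nexists>z. f z \<noteq> f 0"
  have "polynomial_map f"
    unfolding polynomial_map_def
    by (rule exI[of _ "{\<lambda>_. 0}"], rule exI[of _ "\<lambda>_. f 0"]) (use const in auto)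
  with assms show False by (simp add: transcendental_entire_def)
qed

lemma entire_unbounded:
  assumes "entire f" "f z0 \<noteq> f 0"
  shows "\<exists>z. B < cmod (f z)"
proof (rule ccontr)
  assume "\<nexists>z. B < cmod (f z)"
  then have "bounded (range (\<lambda>t. f (t *s z0)))"
    by (auto simp: bounded_iff not_less)
  then have "(\<lambda>t. f (t *s z0)) constant_on UNIV"
    using Liouville_theorem entire_line_holomorphic assms(1) by blast
  then have "f (1 *s z0) = f (0 *s z0)"
    unfolding constant_on_def by (metis UNIV_I)
  with assms(2) show False by simp
qed

section \<open>Complete circular domains\<close>

lemma circular_domainD:
  assumes "bounded_complete_circular_domain D" "z \<in> D" "\<And>j. cmod (w $ j) \<le> cmod (z $ j)"
  shows "w \<in> D"
  using assms unfolding bounded_complete_circular_domain_def by blast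

lemma zero_in_circular_domain:
  assumes "bounded_complete_circular_domain D"
  shows "0 \<in> D"
proof -
  obtain z where "z \<in> D" using assms by (auto simp: bounded_complete_circular_domain_def)
  then show ?thesis by (rule circular_domainD[OF assms]) simp
qed

text \<open>A maximum over the closure of \<open>D\<close> thus becomes a value at a point of any larger multiple of
  \<open>D\<close>. Points of \<open>D\<close> close to \<open>z\<close> dominate \<open>s *\<^sub>R z\<close> coordinatewise: where \<open>z\<close> vanishes there is
  nothing to dominate, and elsewhere the factor \<open>s < 1\<close> leaves room.\<close>

lemma scaleR_closure_circular_domain:
  assumes D: "bounded_complete_circular_domain D" and z: "z \<in> closure D" and s: "0 \<le> s" "s < 1"
  shows "s *\<^sub>R z \<in> D"
proof -
  obtain x where x: "\<And>n. x n \<in> D" "x \<longlonglongrightarrow> z"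
    using z closure_sequential by metis
  have "\<forall>\<^sub>F n in sequentially. cmod ((s *\<^sub>R z) $ j) \<le> cmod (x n $ j)" for j
  proof (cases "z $ j = 0")
    case False
    have "(\<lambda>n. cmod (x n $ j)) \<longlonglongrightarrow> cmod (z $ j)"
      by (intro tendsto_intros x)
    moreover have "s * cmod (z $ j) < cmod (z $ j)" using False s by simp
    ultimately have "\<forall>\<^sub>F n in sequentially. s * cmod (z $ j) < cmod (x n $ j)"
      by (rule order_tendstoD)
    then show ?thesis by eventually_elim (use s in simp)
  qed simp
  then have "\<forall>\<^sub>F n in sequentially. \<forall>j. cmod ((s *\<^sub>R z) $ j) \<le> cmod (x n $ j)"
    by (rule eventually_all_finite)
  then obtain n where "\<And>j. cmod ((s *\<^sub>R z) $ j) \<le> cmod (x n $ j)"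
    using eventually_happens'[OF sequentially_bot] by blast
  then show ?thesis by (rule circular_domainD[OF D x(1)])
qed

text \<open>The parameters \<open>t\<close> for which \<open>t *s z\<close> lies in the dilated domain form an open set containing
  \<open>t0\<close>, so \<open>t0\<close> is an interior maximum of an entire function of one variable. The maximum principle
  then propagates constancy from this set to the whole plane, hence to \<open>t = 0\<close>.\<close>

lemma entire_constant_on_maximal_line:
  assumes f: "entire f" and D: "open D" and R: "0 < R" and u: "inverse R *\<^sub>R (t0 *s z) \<in> D"
    and max: "\<And>w. w \<in> D \<Longrightarrow> cmod (f (R *\<^sub>R w)) \<le> cmod (f (t0 *s z))"
  shows "f (t *s z) = f 0"
proof -
  let ?U = "(\<lambda>t. inverse R *\<^sub>R (t *s z)) -` D"
  have "continuous_on UNIV (\<lambda>t. inverse R *\<^sub>R (t *s z))"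
    by (intro continuous_intros linear_continuous_on bounded_linear_complex_line)
  then have "open ?U" using D by (simp add: continuous_on_open_vimage)
  moreover have "cmod (f (t *s z)) \<le> cmod (f (t0 *s z))" if "t \<in> ?U" for t
    using max[of "inverse R *\<^sub>R (t *s z)"] that R by simp
  ultimately have "(\<lambda>t. f (t *s z)) constant_on UNIV"
    using maximum_modulus_principle[OF entire_line_holomorphic[OF f] open_UNIV connected_UNIV,
        of ?U t0 z] u by auto
  then have "f (t *s z) = f (0 *s z)" unfolding constant_on_def by (metis UNIV_I)
  then show ?thesis by simp
qed

text \<open>Suppose the modulus is maximal at \<open>R *\<^sub>R u\<close>. Then \<open>f\<close> is constant on the line through that
  point and the origin, so the maximum is also attained at the origin. But the origin lies on
  every complex line through it, hence \<open>f\<close> is constant on all of these, that is everywhere.\<close>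

lemma circular_domain_maximum_principle:
  assumes f: "entire f" "f z0 \<noteq> f 0" and D: "bounded_complete_circular_domain D"
    and u: "u \<in> D" and R: "0 < R"
  shows "\<exists>w\<in>D. cmod (f (R *\<^sub>R u)) < cmod (f (R *\<^sub>R w))"
proof (rule ccontr)
  assume "\<not> ?thesis"
  then have max: "cmod (f (R *\<^sub>R w)) \<le> cmod (f (R *\<^sub>R u))" if "w \<in> D" for w
    using that by (meson not_le)
  have oD: "open D" using D by (simp add: bounded_complete_circular_domain_def)
  have "f (R *\<^sub>R u) = f 0"
    using entire_constant_on_maximal_line[OF f(1) oD R, of 1 "R *\<^sub>R u" 1] max u R by simp
  then have "f (1 *s z0) = f 0"
    using entire_constant_on_maximal_line[OF f(1) oD R, of 0 z0 1] max zero_in_circular_domain[OF D] by simp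
  with f(2) show False by simp
qed

section \<open>The maximum modulus\<close>

context
  fixes f :: "complex ^ 'n \<Rightarrow> complex" and D :: "(complex ^ 'n) set"
  assumes entire: "entire f" and D: "bounded_complete_circular_domain D"
begin

text \<open>As a supremum over the fixed set \<open>D\<close> the maximum modulus makes sense at radius \<open>0\<close> too, with
  value \<open>cmod (f 0)\<close> and continuously; \<open>max_modulus D f 0\<close> itself is not this value, because
  division by the radius \<open>0\<close> sends every point to the origin.\<close>

lemma max_modulus_eq_SUP:
  assumes "0 < R"
  shows "max_modulus D f R = (SUP w\<in>D. cmod (f (R *\<^sub>R w)))"
proof -
  have "{cmod (f z) |z. z /\<^sub>R R \<in> D} = (\<lambda>w. cmod (f (R *\<^sub>R w))) ` D"
  proof (intro antisym subsetI)
    fix x assume "x \<in> {cmod (f z) |z. z /\<^sub>R R \<in> D}"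
    then obtain z where "x = cmod (f z)" "z /\<^sub>R R \<in> D" by auto
    then show "x \<in> (\<lambda>w. cmod (f (R *\<^sub>R w))) ` D"
      using assms by (intro image_eqI[of _ _ "z /\<^sub>R R"]) auto
  next
    fix x assume "x \<in> (\<lambda>w. cmod (f (R *\<^sub>R w))) ` D"
    then obtain w where "x = cmod (f (R *\<^sub>R w))" "w \<in> D" by auto
    then show "x \<in> {cmod (f z) |z. z /\<^sub>R R \<in> D}"
      using assms by (intro CollectI exI[of _ "R *\<^sub>R w"]) auto
  qed
  then show ?thesis by (simp add: max_modulus_def)
qed

lemma circular_domain_nonempty: "D \<noteq> {}"
  using zero_in_circular_domain[OF D] by auto

lemma compact_closure_D: "compact (closure D)"
  using D by (simp add: bounded_complete_circular_domain_def)

lemma bdd_above_modulus: "bdd_above ((\<lambda>w. cmod (f (R *\<^sub>R w))) ` D)"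
proof -
  have "compact ((\<lambda>w. cmod (f (R *\<^sub>R w))) ` closure D)"
    by (intro compact_continuous_image compact_closure_D continuous_intros
        continuous_on_compose2[OF entire_continuous_on[OF entire, of UNIV]]) auto
  then show ?thesis
    by (meson bdd_above_mono bounded_imp_bdd_above closure_subset compact_imp_bounded image_mono)
qed

lemma modulus_le_max_modulus: "0 < R \<Longrightarrow> w \<in> D \<Longrightarrow> cmod (f (R *\<^sub>R w)) \<le> max_modulus D f R"
  unfolding max_modulus_eq_SUP by (rule cSUP_upper[OF _ bdd_above_modulus])

text \<open>On the compact set \<open>{0..r} \<times> closure D\<close> the function \<open>cmod (f (R *\<^sub>R w))\<close> is uniformly continuous,
  so a small change of the radius moves all members of the supremum, and with them the supremum
  itself, by a uniformly small amount.\<close>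

lemma continuous_on_SUP_modulus:
  "continuous_on {0..r} (\<lambda>R. SUP w\<in>D. cmod (f (R *\<^sub>R w)))" (is "continuous_on _ ?N")
proof -
  let ?K = "{0..r} \<times> closure D"
  let ?\<phi> = "\<lambda>x. cmod (f (fst x *\<^sub>R snd x))"
  have "continuous_on ?K ?\<phi>"
    by (intro continuous_intros continuous_on_compose2[OF entire_continuous_on[OF entire, of UNIV]]) auto
  then have unif: "uniformly_continuous_on ?K ?\<phi>"
    by (intro compact_uniformly_continuous compact_Times compact_closure_D) auto
  show ?thesis
    unfolding continuous_on_iff
  proof (intro ballI allI impI)
    fix x e :: real assume x: "x \<in> {0..r}" and e: "0 < e"
    obtain d where d: "0 < d"
      "\<And>v w. v \<in> ?K \<Longrightarrow> w \<in> ?K \<Longrightarrow> dist w v < d \<Longrightarrow> dist (?\<phi> w) (?\<phi> v) < e / 2"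
      using unif e unfolding uniformly_continuous_on_def by (metis half_gt_zero)
    have le: "?N y \<le> ?N z + e / 2" if "y \<in> {0..r}" "z \<in> {0..r}" "dist y z < d" for y z
    proof (rule cSUP_least[OF circular_domain_nonempty])
      fix w assume w: "w \<in> D"
      then have "w \<in> closure D" using closure_subset by auto
      with that have "dist (?\<phi> (y, w)) (?\<phi> (z, w)) < e / 2"
        by (intro d(2)) (auto simp: dist_Pair_Pair)
      moreover have "cmod (f (z *\<^sub>R w)) \<le> ?N z"
        by (rule cSUP_upper[OF w bdd_above_modulus])
      ultimately show "cmod (f (y *\<^sub>R w)) \<le> ?N z + e / 2"
        unfolding dist_real_def fst_conv snd_conv by linarith
    qed
    show "\<exists>d>0. \<forall>y\<in>{0..r}. dist y x < d \<longrightarrow> dist (?N y) (?N x) < e"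
    proof (intro exI[of _ d] conjI ballI impI d(1))
      fix y assume "y \<in> {0..r}" "dist y x < d"
      then have "?N y \<le> ?N x + e / 2" "?N x \<le> ?N y + e / 2"
        using le x by (auto simp: dist_commute)
      then show "dist (?N y) (?N x) < e" using e by (auto simp: dist_real_def)
    qed
  qed
qed

text \<open>The maximum for the smaller radius is attained on a compact set that lies inside the open larger
  dilate of \<open>D\<close>; by the maximum principle some point of that dilate does strictly better.\<close>

lemma strict_mono_on_max_modulus:
  assumes "f z0 \<noteq> f 0"
  shows "strict_mono_on {0<..} (max_modulus D f)"
proof (rule strict_mono_onI)
  fix r R :: real assume "r \<in> {0<..}" "R \<in> {0<..}" and less: "r < R"
  then have r: "0 < r" and R: "0 < R" by auto
  have "continuous_on (closure D) (\<lambda>w. cmod (f (r *\<^sub>R w)))"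
    by (intro continuous_intros continuous_on_compose2[OF entire_continuous_on[OF entire, of UNIV]]) auto
  then obtain w0 where w0: "w0 \<in> closure D"
      "\<And>w. w \<in> closure D \<Longrightarrow> cmod (f (r *\<^sub>R w)) \<le> cmod (f (r *\<^sub>R w0))"
    using continuous_attains_sup[OF compact_closure_D] circular_domain_nonempty by (metis closure_eq_empty)
  \<comment> \<open>The maximum point for radius \<open>r\<close>, in the coordinates of radius \<open>R\<close>.\<close>
  define u where "u = (r / R) *\<^sub>R w0"
  have u: "u \<in> D"
    unfolding u_def by (rule scaleR_closure_circular_domain[OF D w0(1)]) (use r less in auto)
  then obtain w where w: "w \<in> D" "cmod (f (R *\<^sub>R u)) < cmod (f (R *\<^sub>R w))"
    using circular_domain_maximum_principle[OF entire assms D _ R] by blast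
  have "max_modulus D f r \<le> cmod (f (r *\<^sub>R w0))"
    unfolding max_modulus_eq_SUP[OF r]
    by (rule cSUP_least[OF circular_domain_nonempty]) (use w0(2) closure_subset in blast)
  also have "\<dots> = cmod (f (R *\<^sub>R u))" using R by (simp add: u_def)
  also note w(2)
  also have "cmod (f (R *\<^sub>R w)) \<le> max_modulus D f R"
    by (rule modulus_le_max_modulus[OF R w(1)])
  finally show "max_modulus D f r < max_modulus D f R" .
qed

text \<open>Liouville's theorem on a line gives a point where \<open>f\<close> is large, and since \<open>D\<close> is a neighbourhood
  of the origin, every point lies in all sufficiently large dilates of \<open>D\<close>.\<close>

lemma max_modulus_unbounded:
  assumes "f z0 \<noteq> f 0"
  shows "\<exists>R>0. B < max_modulus D f R"
proof -
  obtain z where z: "B < cmod (f z)" using entire_unbounded[OF entire assms] by blast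
  have "open D" using D by (simp add: bounded_complete_circular_domain_def)
  moreover have "((\<lambda>R::real. inverse R *\<^sub>R z) \<longlongrightarrow> 0 *\<^sub>R z) at_top"
    by (intro tendsto_intros tendsto_inverse_0_at_top filterlim_ident)
  ultimately have "\<forall>\<^sub>F R::real in at_top. inverse R *\<^sub>R z \<in> D"
    using zero_in_circular_domain[OF D] by (intro topological_tendstoD) auto
  then have "\<forall>\<^sub>F R::real in at_top. 0 < R \<and> inverse R *\<^sub>R z \<in> D"
    using eventually_gt_at_top[of "0::real"] by eventually_elim simp
  then obtain R where R: "0 < R" "inverse R *\<^sub>R z \<in> D"
    using eventually_happens'[OF trivial_limit_at_top_linorder] by blast
  with modulus_le_max_modulus[OF R] z show ?thesis by (intro exI[of _ R]) auto
qed

lemma filterlim_max_modulus: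
  assumes "f z0 \<noteq> f 0"
  shows "filterlim (max_modulus D f) at_top at_top"
  unfolding filterlim_at_top
proof
  fix B
  obtain R where R: "0 < R" "B < max_modulus D f R"
    using max_modulus_unbounded[OF assms] by blast
  show "\<forall>\<^sub>F r in at_top. B \<le> max_modulus D f r"
    using eventually_gt_at_top[of R]
  proof eventually_elim
    case (elim r)
    then have "max_modulus D f R < max_modulus D f r"
      using strict_mono_onD[OF strict_mono_on_max_modulus[OF assms]] R by auto
    with R show ?case by simp
  qed
qed

text \<open>Values above \<open>cmod (f 0)\<close> are attained by the intermediate value theorem, starting at radius
  \<open>0\<close>. Conversely, no radius gives \<open>cmod (f 0)\<close> or less: the centre of \<open>D\<close> is never a maximum
  point.\<close>

lemma max_modulus_image:
  assumes "f z0 \<noteq> f 0"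
  shows "max_modulus D f ` {0<..} = {cmod (f 0)<..}"
proof (intro antisym subsetI)
  fix y assume "y \<in> max_modulus D f ` {0<..}"
  then obtain R where R: "0 < R" "y = max_modulus D f R" by auto
  obtain w where w: "w \<in> D" "cmod (f (R *\<^sub>R 0)) < cmod (f (R *\<^sub>R w))"
    using circular_domain_maximum_principle[OF entire assms D zero_in_circular_domain[OF D] R(1)] by blast
  with modulus_le_max_modulus[OF R(1) w(1)] R(2) show "y \<in> {cmod (f 0)<..}" by simp
next
  fix y assume y: "y \<in> {cmod (f 0)<..}"
  let ?N = "\<lambda>R. SUP w\<in>D. cmod (f (R *\<^sub>R w))"
  obtain R where R: "0 < R" "y < max_modulus D f R"
    using max_modulus_unbounded[OF assms] by blast
  have N0: "?N 0 = cmod (f 0)" using circular_domain_nonempty by simp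
  obtain x where x: "0 \<le> x" "x \<le> R" "?N x = y"
    using IVT'[of ?N 0 y R] R y N0 continuous_on_SUP_modulus max_modulus_eq_SUP[OF R(1)] by auto
  with N0 y have "0 < x" by (cases "x = 0") auto
  with x max_modulus_eq_SUP show "y \<in> max_modulus D f ` {0<..}" by (intro image_eqI[of _ _ x]) auto
qed

lemma inv_max_modulus:
  assumes "f z0 \<noteq> f 0" "cmod (f 0) < y"
  shows "0 < inv_max_modulus D f y" "max_modulus D f (inv_max_modulus D f y) = y"
proof -
  have inj: "inj_on (max_modulus D f) {0<..}"
    using strict_mono_on_max_modulus[OF assms(1)] strict_mono_on_imp_inj_on by blast
  have y: "y \<in> max_modulus D f ` {0<..}"
    using assms max_modulus_image by simp
  show "0 < inv_max_modulus D f y"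
    using the_inv_into_into[OF inj y order_refl] by (simp add: inv_max_modulus_def)
  show "max_modulus D f (inv_max_modulus D f y) = y"
    using f_the_inv_into_f[OF inj y] by (simp add: inv_max_modulus_def)
qed

lemma inv_max_modulus_max_modulus:
  assumes "f z0 \<noteq> f 0" "0 < R"
  shows "inv_max_modulus D f (max_modulus D f R) = R"
  unfolding inv_max_modulus_def
  using assms strict_mono_on_max_modulus strict_mono_on_imp_inj_on
  by (intro the_inv_into_f_f) auto

lemma filterlim_inv_max_modulus:
  assumes "f z0 \<noteq> f 0"
  shows "filterlim (inv_max_modulus D f) at_top at_top"
  unfolding filterlim_at_top
proof
  fix B :: real
  show "\<forall>\<^sub>F y in at_top. B \<le> inv_max_modulus D f y"
    using eventually_gt_at_top[of "cmod (f 0)"] eventually_gt_at_top[of "max_modulus D f (max B 1)"]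
  proof eventually_elim
    case (elim y)
    note inv = inv_max_modulus[OF assms elim(1)]
    have "max B 1 \<le> inv_max_modulus D f y"
    proof (rule ccontr)
      assume "\<not> ?thesis"
      then have "max_modulus D f (inv_max_modulus D f y) < max_modulus D f (max B 1)"
        using strict_mono_onD[OF strict_mono_on_max_modulus[OF assms]] inv(1) by auto
      with inv(2) elim(2) show False by simp
    qed
    then show ?case by simp
  qed
qed

end

section \<open>Relative orders\<close>

lemma filterlim_iter_ln: "filterlim (iter_ln k) at_top at_top"
proof (induction k)
  case 0
  show ?case by (simp add: iter_ln_def id_def filterlim_ident)
next
  case (Suc k)
  have "iter_ln (Suc k) = (\<lambda>x. ln (iter_ln k x))" by (simp add: iter_ln_def fun_eq_iff)
  with filterlim_compose[OF ln_at_top Suc.IH] show ?case by simp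
qed

text \<open>Exchanging \<open>f\<close> and \<open>g\<close> yields a map that also tends to infinity and is eventually a right
  inverse, so each neighbourhood of infinity is covered by the image of another one. This is what
  transfers limits along \<open>h\<close> exactly, and not just as inequalities.\<close>

lemma filtermap_inv_max_modulus_max_modulus:
  fixes f g :: "complex ^ 'n \<Rightarrow> complex"
  assumes f: "entire f" "f z0 \<noteq> f 0" and g: "entire g" "g z1 \<noteq> g 0"
    and D: "bounded_complete_circular_domain D"
  shows "filtermap (\<lambda>R. inv_max_modulus D g (max_modulus D f R)) at_top = at_top"
proof (rule filtermap_fun_inverse[where g = "\<lambda>R. inv_max_modulus D f (max_modulus D g R)"])
  show "filterlim (\<lambda>R. inv_max_modulus D g (max_modulus D f R)) at_top at_top"
    using filterlim_compose[OF filterlim_inv_max_modulus[OF g(1) D g(2)]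
        filterlim_max_modulus[OF f(1) D f(2)]] .
  show "filterlim (\<lambda>R. inv_max_modulus D f (max_modulus D g R)) at_top at_top"
    using filterlim_compose[OF filterlim_inv_max_modulus[OF f(1) D f(2)]
        filterlim_max_modulus[OF g(1) D g(2)]] .
  have "\<forall>\<^sub>F R in at_top. cmod (f 0) < max_modulus D g R"
    using filterlim_max_modulus[OF g(1) D g(2)] by (simp add: filterlim_at_top_dense)
  then show "\<forall>\<^sub>F R in at_top. inv_max_modulus D g
      (max_modulus D f (inv_max_modulus D f (max_modulus D g R))) = R"
    using eventually_gt_at_top[of "0::real"]
    by eventually_elim
      (simp add: inv_max_modulus(2)[OF f(1) D f(2)] inv_max_modulus_max_modulus[OF g(1) D g(2)])
qed

lemma has_index_pair_upper_order:
  assumes "has_index_pair D f m q"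
  shows "0 < upper_order D m q f" "upper_order D m q f < \<infinity>"
proof -
  have "0 < upper_order D m q f \<and> upper_order D m q f < \<infinity>"
    using assms unfolding has_index_pair_def
    by (auto split: if_splits intro: less_trans[of 0 1])
  then show "0 < upper_order D m q f" "upper_order D m q f < \<infinity>" by auto
qed

text \<open>When both lower orders vanish, \<open>Q\<close> contains just the quotient of the upper orders. In all
  cases every element of \<open>Q\<close> lies between the two relative orders, which is all that the minimum
  and the maximum require.\<close>

theorem theorem2:
  fixes f g :: "complex ^ 'n \<Rightarrow> complex"
    and D :: "(complex ^ 'n) set"
    and m p q :: nat
  assumes "transcendental_entire f" and "transcendental_entire g"
    and "bounded_complete_circular_domain D"
    and "m \<ge> q" and "q \<ge> 1" and "m \<ge> p" and "p \<ge> 1"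
    and "has_index_pair D f m q" and "has_index_pair D g m p"
  defines "Q \<equiv> determinate_quotients
      {(lower_order D m q f, lower_order D m p g), (upper_order D m q f, upper_order D m p g)}"
  shows "lower_order D m q f / upper_order D m p g \<le> relative_lower_order D p q g f
    \<and> relative_lower_order D p q g f \<le> Min Q
    \<and> Min Q \<le> Max Q
    \<and> Max Q \<le> relative_upper_order D p q g f
    \<and> relative_upper_order D p q g f \<le> upper_order D m q f / lower_order D m p g"
proof -
  have f: "entire f" and g: "entire g"
    using assms by (auto simp: transcendental_entire_def)
  obtain z0 z1 where z0: "f z0 \<noteq> f 0" and z1: "g z1 \<noteq> g 0"
    using transcendental_entire_not_constant assms(1,2) by metis
  note D = assms(3)
  define h where "h = (\<lambda>R. inv_max_modulus D g (max_modulus D f R))"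
  define a where "a = (\<lambda>R. iter_ln m (max_modulus D f R) / iter_ln q R)"
  define b where "b = (\<lambda>r. iter_ln m (max_modulus D g r) / iter_ln p r)"
  have h: "filtermap h at_top = at_top"
    unfolding h_def by (rule filtermap_inv_max_modulus_max_modulus[OF f z0 g z1 D])
  then have h_lim: "filterlim h at_top at_top" by (simp add: filterlim_def)
  have F_lim: "filterlim (max_modulus D f) at_top at_top"
    by (rule filterlim_max_modulus[OF f D z0])
  have evs: "\<forall>\<^sub>F R in at_top. cmod (g 0) < max_modulus D f R"
    "\<forall>\<^sub>F R in at_top. 0 < iter_ln m (max_modulus D f R)"
    "\<forall>\<^sub>F R in at_top. 0 < iter_ln p (h R)"
    "\<forall>\<^sub>F R in at_top. 0 < iter_ln q R"
    using F_lim filterlim_compose[OF filterlim_iter_ln F_lim]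
      filterlim_compose[OF filterlim_iter_ln h_lim] filterlim_iter_ln
    by (simp_all add: filterlim_at_top_dense)
  \<comment> \<open>The common factor \<open>iter_ln m (max_modulus D f R)\<close> cancels, as it is positive for large \<open>R\<close>.\<close>
  then have "\<forall>\<^sub>F R in at_top. 0 < a R \<and> 0 < b (h R) \<and>
      ereal (iter_ln p (h R) / iter_ln q R) = ereal (a R / b (h R))"
  proof eventually_elim
    case (elim R)
    have "max_modulus D g (h R) = max_modulus D f R"
      unfolding h_def by (rule inv_max_modulus(2)[OF g D z1 elim(1)])
    with elim show ?case by (simp add: a_def b_def)
  qed
  then have pos: "\<forall>\<^sub>F R in at_top. 0 < a R \<and> 0 < b (h R)"
    and quot: "\<forall>\<^sub>F R in at_top. ereal (iter_ln p (h R) / iter_ln q R) = ereal (a R / b (h R))"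
    by (auto elim: eventually_mono)
  have orders:
    "upper_order D m q f = Limsup at_top (\<lambda>R. ereal (a R))"
    "lower_order D m q f = Liminf at_top (\<lambda>R. ereal (a R))"
    "upper_order D m p g = Limsup at_top (\<lambda>R. ereal (b (h R)))"
    "lower_order D m p g = Liminf at_top (\<lambda>R. ereal (b (h R)))"
    "relative_upper_order D p q g f = Limsup at_top (\<lambda>R. ereal (a R / b (h R)))"
    "relative_lower_order D p q g f = Liminf at_top (\<lambda>R. ereal (a R / b (h R)))"
    using Limsup_filtermap[of h at_top "\<lambda>r. ereal (b r)"] Liminf_filtermap[of h at_top "\<lambda>r. ereal (b r)"]
      Limsup_eq[OF quot] Liminf_eq[OF quot]
    by (simp_all add: upper_order_def lower_order_def relative_upper_order_def
        relative_lower_order_def a_def b_def h_def[symmetric] h, simp_all add: h_def)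
  \<comment> \<open>The index pairs make both upper orders positive and finite. Positivity
    excludes \<open>0 / 0\<close> in every quotient except the one of the two lower orders.\<close>
  note \<rho> = has_index_pair_upper_order[OF assms(8)] has_index_pair_upper_order[OF assms(9)]
  have nonzero: "upper_order D m q f \<noteq> 0" "upper_order D m p g \<noteq> 0"
    using \<rho> by auto
  have fin: "Limsup at_top (\<lambda>R. ereal (b (h R))) < \<infinity>"
    using \<rho> orders by simp
  note ctxt = trivial_limit_at_top_linorder pos fin
  have outer: "lower_order D m q f / upper_order D m p g \<le> relative_lower_order D p q g f"
    "relative_upper_order D p q g f \<le> upper_order D m q f / lower_order D m p g"
    using Liminf_quotient_ge[OF ctxt] Limsup_quotient_le[OF ctxt] nonzero
    unfolding orders[symmetric] by blast+
  have Q: "finite Q" "Q \<noteq> {}"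
  proof -
    have "Q \<subseteq> {lower_order D m q f / lower_order D m p g, upper_order D m q f / upper_order D m p g}"
      by (auto simp: Q_def determinate_quotients_def)
    then show "finite Q" by (rule finite_subset) simp
    \<comment> \<open>The quotient of the upper orders is always determinate.\<close>
    show "Q \<noteq> {}" using nonzero by (auto simp: Q_def determinate_quotients_def)
  qed
  have inner: "relative_lower_order D p q g f \<le> x \<and> x \<le> relative_upper_order D p q g f"
    if "x \<in> Q" for x
    using that Liminf_quotient_le_Liminf[OF ctxt] Limsup_quotient_ge_Liminf[OF ctxt]
      Liminf_quotient_le_Limsup[OF ctxt] Limsup_quotient_ge_Limsup[OF ctxt]
    unfolding Q_def determinate_quotients_def orders[symmetric] by blast
  show ?thesis
    using outer inner Q by (auto intro: Min_le_iff[THEN iffD2])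
qed

end
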